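(* Let $k\ge 2$. For every integer $r\ge 0$, \[ \sum_{n_1,\ldots,n_k\le x}\beta_r(n_1,\ldots,n_k)=C_{k,r}\,x^k+O\big(x^{k-1}(\log x)^{k-1}\big),\qquad C_{k,r}=\sum_{j=r}^{k(k-1)/2}(-1)^{j-r}\binom{j}{r}\sum_{\substack{E\subseteq V^{(2)}\\|E|=j}}A_{(V,E)}, \] and for every integer $r\ge 1$, \[ \sum_{n_1,\ldots,n_k\le x}\beta'_r(n_1,\ldots,n_k)=C'_{k,r}\,x^k+O\big(x^{k-1}(\log x)^{k-1}\big),\qquad C'_{k,r}=\sum_{j=r}^{k(k-1)/2}(-1)^{j-r}\binom{j-1}{r-1}\sum_{\substack{E\subseteq V^{(2)}\\|E|=j}}A_{(V,E)}. \] In particular $C_{k,r}$ and $C'_{k,r}$ are the asymptotic densities of the $k$-tuples $(n_1,\ldots,n_k)\in\mathbb{N}^k$ for which $\gcd(n_i,n_j)=1$ holds for exactly $r$, respectively at least $r$, pairs $1\le i<j\le k$.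
   Context: $V=\{1,\ldots,k\}$, $V^{(2)}=\{\{i,j\}:1\le i<j\le k\}$. $\beta_r(n_1,\ldots,n_k)=1$ if exactly $r$ pairs $(n_i,n_j)$ with $1\le i<j\le k$ are coprime and $0$ otherwise; $\beta'_r(n_1,\ldots,n_k)=1$ if at least $r$ such pairs are coprime and $0$ otherwise. For $E\subseteq V^{(2)}$, $A_{(V,E)}$ is the asymptotic density of the $k$-tuples with $\gcd(n_i,n_j)=1$ for all $\{i,j\}\in E$, given by $A_{(V,E)}=\prod_p\Big(\sum_{m=0}^k\frac{i_m}{p^m}\big(1-\frac1p\big)^{k-m}\Big)$, where $i_m$ is the number of independent sets of size $m$ in the graph $(V,E)$ and the product runs over primes. *)

theory Defs
  imports "HOL-Analysis.Analysis" "HOL-Library.Landau_Symbols"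
begin

definition vertices :: "nat \<Rightarrow> nat set" where
  "vertices k = {1..k}"

definition vertex_pairs :: "nat \<Rightarrow> nat set set" where
  "vertex_pairs k = {{i, j} | i j. 1 \<le> i \<and> i < j \<and> j \<le> k}"

text \<open>The \<open>k\<close>-tuples of positive integers, as functions on \<open>{1..k}\<close> that are \<open>undefined\<close>
  elsewhere, so that distinct functions are distinct tuples.\<close>

definition pos_tuples :: "nat \<Rightarrow> (nat \<Rightarrow> nat) set" where
  "pos_tuples k = vertices k \<rightarrow>\<^sub>E {m. 1 \<le> m}"

definition pos_tuples_le :: "nat \<Rightarrow> real \<Rightarrow> (nat \<Rightarrow> nat) set" where
  "pos_tuples_le k x = vertices k \<rightarrow>\<^sub>E {m. 1 \<le> m \<and> real m \<le> x}"

lemma finite_pos_tuples_le: "finite (pos_tuples_le k x)"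
proof -
  have "{m::nat. 1 \<le> m \<and> real m \<le> x} \<subseteq> {..nat \<lfloor>x\<rfloor>}"
    by (auto simp: le_nat_iff le_floor_iff)
  then have "finite {m::nat. 1 \<le> m \<and> real m \<le> x}"
    using finite_subset by blast
  then show ?thesis
    unfolding pos_tuples_le_def vertices_def by (intro finite_PiE) auto
qed

definition coprime_pairs :: "nat \<Rightarrow> (nat \<Rightarrow> nat) \<Rightarrow> (nat \<times> nat) set" where
  "coprime_pairs k n = {(i, j). 1 \<le> i \<and> i < j \<and> j \<le> k \<and> gcd (n i) (n j) = 1}"

definition beta_exact :: "nat \<Rightarrow> nat \<Rightarrow> (nat \<Rightarrow> nat) \<Rightarrow> real" where
  "beta_exact k r n = (if card (coprime_pairs k n) = r then 1 else 0)"

definition beta_atleast :: "nat \<Rightarrow> nat \<Rightarrow> (nat \<Rightarrow> nat) \<Rightarrow> real" where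
  "beta_atleast k r n = (if card (coprime_pairs k n) \<ge> r then 1 else 0)"

definition independent_in :: "nat set set \<Rightarrow> nat set \<Rightarrow> bool" where
  "independent_in E S \<longleftrightarrow> (\<forall>i\<in>S. \<forall>j\<in>S. {i, j} \<notin> E)"

definition num_independent :: "nat \<Rightarrow> nat set set \<Rightarrow> nat \<Rightarrow> nat" where
  "num_independent k E m = card {S. S \<subseteq> vertices k \<and> card S = m \<and> independent_in E S}"

text \<open>The Euler product over all primes; non-primes contribute the factor 1.\<close>

definition A_graph :: "nat \<Rightarrow> nat set set \<Rightarrow> real" where
  "A_graph k E = (\<Prod>p. if prime p
     then \<Sum>m=0..k. real (num_independent k E m) / real p ^ m * (1 - 1 / real p) ^ (k - m)
     else 1)"

definition C_exact :: "nat \<Rightarrow> nat \<Rightarrow> real" where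
  "C_exact k r = (\<Sum>j=r..k * (k - 1) div 2. (- 1) ^ (j - r) * real (j choose r) *
     (\<Sum>E | E \<subseteq> vertex_pairs k \<and> card E = j. A_graph k E))"

definition C_atleast :: "nat \<Rightarrow> nat \<Rightarrow> real" where
  "C_atleast k r = (\<Sum>j=r..k * (k - 1) div 2. (- 1) ^ (j - r) * real ((j - 1) choose (r - 1)) *
     (\<Sum>E | E \<subseteq> vertex_pairs k \<and> card E = j. A_graph k E))"

definition has_asymptotic_density :: "nat \<Rightarrow> (nat \<Rightarrow> nat) set \<Rightarrow> real \<Rightarrow> bool" where
  "has_asymptotic_density k T d \<longleftrightarrow>
     (\<lambda>N. real (card (T \<inter> pos_tuples_le k (real N))) / real N ^ k) \<longlonglongrightarrow> d"

end

theory Submission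
  imports Defs "HOL-Computational_Algebra.Primes"
begin

text \<open>
  Fix a graph \<open>E\<close> and let \<open>h\<close> be the Moebius inverse, over subsets of \<open>V\<close>, of the indicator of
  independent sets. A tuple \<open>n\<close> is coprime along \<open>E\<close> iff for every prime \<open>p \<le> x\<close> the set
  \<open>{i. p dvd n i}\<close> is independent, so its indicator is \<open>\<Prod>\<^bsub>p \<le> x\<^esub> \<Sum>\<^bsub>S\<^esub> h S [p dvd n i for i \<in> S]\<close>.
  Expanding the finite product over all maps \<open>T\<close> from primes to subsets of \<open>V\<close> and summing over \<open>n\<close> gives
  products of terms \<open>\<lfloor>x / d i\<rfloor>\<close>, where \<open>d i\<close> is the product of the \<open>p\<close> with \<open>i \<in> T p\<close>.
  Without the rounding the sum refolds to \<open>x ^ k\<close> times the partial Euler product over \<open>p \<le> x\<close>. The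
  rounding error is at most \<open>x ^ (k - 1)\<close> times a sum over \<open>i\<close> of
  \<open>\<Prod>\<^bsub>p \<le> x\<^esub> \<Sum>\<^bsub>S\<^esub> \<bar>h S\<bar> / p ^ card (S - {i})\<close>. Since \<open>h\<close> vanishes on singletons, the factors
  are at most \<open>(1 + 1 / p) ^ (k - 1) * (1 + O(1 / p\<^sup>2))\<close>, and Mertens' bound
  \<open>\<Prod>\<^bsub>p \<le> x\<^esub> (1 + 1 / p) = O(ln x)\<close> finishes the argument. The counts of tuples with exactly or at
  least \<open>r\<close> coprime pairs follow by binomial inversion over all \<open>E\<close>.
\<close>

subsection \<open>Sums and products over primes\<close>

definition primes_le :: "real \<Rightarrow> nat set" where
  "primes_le x = {p. prime p \<and> real p \<le> x}"

lemma finite_nat_le_real: "finite {m::nat. real m \<le> x}"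
  by (rule finite_subset[of _ "{..nat \<lfloor>x\<rfloor>}"]) (auto simp: le_nat_iff le_floor_iff)

lemma finite_primes_le [simp]: "finite (primes_le x)"
  unfolding primes_le_def by (rule finite_subset[OF _ finite_nat_le_real[of x]]) auto

lemma prod_primes_dvd_iff:
  fixes A :: "nat set"
  assumes "finite A" "\<And>p. p \<in> A \<Longrightarrow> prime p"
  shows "\<Prod>A dvd m \<longleftrightarrow> (\<forall>p\<in>A. p dvd m)"
  using assms
proof (induction A rule: finite_induct)
  case (insert q A)
  have "coprime q (\<Prod>A)"
    using insert by (intro prod_coprime_right primes_coprime) auto
  then show ?case
    using insert by (auto intro: divides_mult dest: dvd_mult_left dvd_mult_right)
qed auto

lemma card_multiples_le:
  fixes x :: real
  assumes "d > 0" "x \<ge> 0"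
  shows "card {m::nat. 1 \<le> m \<and> real m \<le> x \<and> d dvd m} = nat \<lfloor>x / real d\<rfloor>"
proof -
  have "{m::nat. 1 \<le> m \<and> real m \<le> x \<and> d dvd m} = (\<lambda>c. d * c) ` {1..nat \<lfloor>x / real d\<rfloor>}"
  proof -
    have le: "real (d * c) \<le> x \<longleftrightarrow> c \<le> nat \<lfloor>x / real d\<rfloor>" for c
      using assms by (simp add: le_nat_iff le_floor_iff field_simps)
    show ?thesis
    proof (intro set_eqI iffI)
      fix m assume m: "m \<in> {m::nat. 1 \<le> m \<and> real m \<le> x \<and> d dvd m}"
      then obtain c where c: "m = d * c" by (auto elim: dvdE)
      have "c \<le> nat \<lfloor>x / real d\<rfloor>" using m unfolding c le[symmetric] by simp
      moreover have "1 \<le> c" using m c by (cases c) auto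
      ultimately have "c \<in> {1..nat \<lfloor>x / real d\<rfloor>}" unfolding atLeastAtMost_iff by blast
      then show "m \<in> (\<lambda>c. d * c) ` {1..nat \<lfloor>x / real d\<rfloor>}"
        unfolding c by (rule imageI)
    next
      fix m assume "m \<in> (\<lambda>c. d * c) ` {1..nat \<lfloor>x / real d\<rfloor>}"
      then obtain c where c: "m = d * c" "c \<in> {1..nat \<lfloor>x / real d\<rfloor>}"
        by (rule imageE)
      have "real m \<le> x" unfolding c(1) using c(2) le by simp
      then show "m \<in> {m::nat. 1 \<le> m \<and> real m \<le> x \<and> d dvd m}"
        using c assms(1) by auto
    qed
  qed
  also have "card \<dots> = nat \<lfloor>x / real d\<rfloor>"
    using assms by (subst card_image) (auto simp: inj_on_def)
  finally show ?thesis .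
qed

lemma card_multiples_le_bounds:
  fixes x :: real
  assumes "d > 0" "x \<ge> 0"
  defines "c \<equiv> real (card {m::nat. 1 \<le> m \<and> real m \<le> x \<and> d dvd m})"
  shows "c \<le> x / real d" and "x / real d - 1 \<le> c"
proof -
  have "c = of_int \<lfloor>x / real d\<rfloor>"
    unfolding c_def card_multiples_le[OF assms(1,2)] using assms(1,2) by simp
  then show "c \<le> x / real d" "x / real d - 1 \<le> c" by linarith+
qed

text \<open>The product of the distinct primes in \<open>A\<close> divides \<open>m\<close>, hence
  is at most \<open>m\<close>; take logarithms.\<close>

lemma sum_ln_prime_divisors_le:
  assumes "m > 0" "finite A" "\<And>p. p \<in> A \<Longrightarrow> prime p \<and> p dvd m"
  shows "(\<Sum>p\<in>A. ln (real p)) \<le> ln (real m)"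
proof -
  have "\<Prod>A dvd m" using assms by (subst prod_primes_dvd_iff) auto
  then have le: "\<Prod>A \<le> m" using assms by (simp add: dvd_imp_le)
  have pos: "\<And>p. p \<in> A \<Longrightarrow> p > 0" using assms(3) prime_gt_0_nat by blast
  have "(\<Sum>p\<in>A. ln (real p)) = ln (\<Prod>p\<in>A. real p)"
    using pos assms(2) by (subst ln_prod) auto
  also have "\<dots> \<le> ln (real m)"
    using le pos by (subst ln_le_cancel_iff) 
      (auto simp: assms intro!: prod_pos simp flip: of_nat_prod)
  finally show ?thesis .
qed

text \<open>Counting prime factors in \<open>n!\<close>; rounding down costs at most a factor 2 since \<open>p \<le> x\<close>.\<close>

lemma sum_ln_prime_over_prime_le:
  fixes x :: real
  assumes "x \<ge> 1"
  shows "(\<Sum>p\<in>primes_le x. ln (real p) / real p) \<le> 2 * ln x"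
proof -
  define B where "B = {m::nat. 1 \<le> m \<and> real m \<le> x}"
  have [simp]: "finite B"
    unfolding B_def by (rule finite_subset[OF _ finite_nat_le_real[of x]]) auto
  have pos: "p > 0" if "p \<in> primes_le x" for p using that by (auto simp: primes_le_def prime_gt_0_nat)
  have "B = {m::nat. 1 \<le> m \<and> real m \<le> x \<and> 1 dvd m}" by (auto simp: B_def)
  then have cB: "real (card B) \<le> x"
    using card_multiples_le_bounds(1)[of 1 x] assms by simp
  have half: "x / (2 * real p) \<le> real (card {m\<in>B. p dvd m})" if p: "p \<in> primes_le x" for p
  proof -
    have eq: "{m\<in>B. p dvd m} = {m::nat. 1 \<le> m \<and> real m \<le> x \<and> p dvd m}" by (auto simp: B_def)
    have "x / real p - 1 \<le> real (card {m\<in>B. p dvd m})"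
      unfolding eq using card_multiples_le_bounds(2)[of p x] assms pos[OF p] by simp
    \<comment> \<open>Since p itself is counted, the count is at least 1 as well as at least x / p -
      1, so twice the count is at least x / p.\<close>
    moreover have "card {m\<in>B. p dvd m} \<ge> 1"
    proof -
      have "p \<in> {m\<in>B. p dvd m}" using p pos[OF p] by (auto simp: B_def primes_le_def)
      then have "card {m\<in>B. p dvd m} \<noteq> 0" by (subst card_0_eq) auto
      then show ?thesis by linarith
    qed
    ultimately show ?thesis by simp
  qed
  have "x / 2 * (\<Sum>p\<in>primes_le x. ln (real p) / real p)
      = (\<Sum>p\<in>primes_le x. ln (real p) * (x / (2 * real p)))"
    by (simp add: sum_distrib_left mult.commute)
  also have "\<dots> \<le> (\<Sum>p\<in>primes_le x. ln (real p) * real (card {m\<in>B. p dvd m}))"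
    using half pos by (intro sum_mono mult_left_mono) (auto intro!: ln_ge_zero simp: Suc_le_eq)
  also have "\<dots> = (\<Sum>p\<in>primes_le x. \<Sum>m\<in>B. of_bool (p dvd m) * ln (real p))"
    by (intro sum.cong refl) (simp add: sum_distrib_right[symmetric] Int_def mult.commute)
  also have "\<dots> = (\<Sum>m\<in>B. \<Sum>p\<in>primes_le x. of_bool (p dvd m) * ln (real p))"
    by (rule sum.swap)
  also have "\<dots> = (\<Sum>m\<in>B. \<Sum>p\<in>{p\<in>primes_le x. p dvd m}. ln (real p))"
    by (intro sum.cong refl sum.mono_neutral_cong_right) auto
  also have "\<dots> \<le> (\<Sum>m\<in>B. ln (real m))"
    by (intro sum_mono sum_ln_prime_divisors_le) (auto simp: B_def primes_le_def)
  also have "\<dots> \<le> (\<Sum>m\<in>B. ln x)"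
    by (intro sum_mono) (auto simp: B_def)
  also have "\<dots> \<le> x * ln x"
    using cB assms by (simp add: mult_right_mono)
  finally show ?thesis using assms by (simp add: field_simps)
qed

text \<open>A telescoping form of the integral test: for n > 1 the n-th summand, multiplied by u, is
  at most the drop of t powr -u from n - 1 to n. The summand 1 on the right is the term n =
  1.\<close>

lemma sum_powr_le:
  fixes u :: real
  assumes u: "u > 0"
  shows "(\<Sum>n=1..N. real n powr - (1 + u)) \<le> 1 + 1 / u"
proof -
  have step: "u * real (Suc n) powr - (1 + u) \<le> real n powr - u - real (Suc n) powr - u"
    if "n > 0" for n
  proof -
    let ?y = "real (Suc n)"
    \<comment> \<open>This chain proves the Bernoulli-type bound 1 + u / y \<le> (1 - 1 / y) powr
      -u; multiplying by y powr -u turns the right side into n powr -u.\<close>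
    have "1 + u * (1 / ?y) \<le> exp (u * (1 / ?y))" by (rule exp_ge_add_one_self)
    also have "\<dots> \<le> exp (u * (- ln (1 - 1 / ?y)))"
    proof -
      have "ln (1 - 1 / ?y) \<le> - (1 / ?y)"
        using ln_add_one_self_le_self2[of "- (1 / ?y)"] that by (simp add: field_simps)
      then show ?thesis using u by (intro iffD2[OF exp_le_cancel_iff] mult_left_mono) auto
    qed
    also have "\<dots> = (1 - 1 / ?y) powr - u"
      using that by (simp add: powr_def)
    finally have "?y powr - u * (1 + u * (1 / ?y)) \<le> ?y powr - u * (1 - 1 / ?y) powr - u"
      by (intro mult_left_mono) auto
    also have "\<dots> = (?y * (1 - 1 / ?y)) powr - u"
      using that by (subst powr_mult) auto
    also have "?y * (1 - 1 / ?y) = real n" by (simp add: field_simps)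
    finally have "?y powr - u * (1 + u * (1 / ?y)) \<le> real n powr - u" .
    moreover have "?y powr - (1 + u) = ?y powr - u / ?y"
      by (simp add: powr_diff powr_minus_divide)
    ultimately show ?thesis by (simp add: algebra_simps)
  qed
  have "u * (\<Sum>n=1..Suc M. real n powr - (1 + u)) \<le> u + 1 - real (Suc M) powr - u" for M
  proof (induction M)
    case (Suc M)
    then show ?case using step[of "Suc M"] by (simp add: algebra_simps)
  qed simp
  then have "u * (\<Sum>n=1..Suc M. real n powr - (1 + u)) \<le> u + 1" for M
    by (rule order_trans) simp
  then have "(\<Sum>n=1..Suc M. real n powr - (1 + u)) \<le> 1 + 1 / u" for M
    using u by (simp add: field_simps)
  then show ?thesis using u by (cases N) auto
qed

text \<open>Expanding the product gives one term per squarefree number composed of primes in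
  \<open>P\<close>. By unique factorisation these numbers are distinct, so the terms form part of
  the Dirichlet sum up to the largest of them.\<close>

lemma prod_one_plus_prime_powr_le:
  fixes s :: real
  assumes fin: "finite P" and pr: "\<And>p. p \<in> P \<Longrightarrow> prime p"
  shows "\<exists>N. (\<Prod>p\<in>P. 1 + real p powr s) \<le> (\<Sum>n=1..N. real n powr s)"
proof -
  have pos: "p > 0" if "p \<in> P" for p using pr[OF that] prime_gt_0_nat by blast
  have inj: "inj_on (\<lambda>X. \<Prod>X) (Pow P)"
  proof (rule inj_onI)
    fix X Y assume X: "X \<in> Pow P" and Y: "Y \<in> Pow P" and eq: "\<Prod>X = \<Prod>Y"
    have mem: "p \<in> Z \<longleftrightarrow> p dvd \<Prod>Z" if "p \<in> P" "Z \<in> Pow P" for p Z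
    proof -
      have "finite Z" using that fin finite_subset by auto
      then have "p dvd \<Prod>Z \<longleftrightarrow> (\<exists>q\<in>Z. p dvd q)"
        using that pr by (subst prime_dvd_prod_iff) auto
      also have "\<dots> \<longleftrightarrow> p \<in> Z"
        using that pr by (metis PowD dvd_refl primes_dvd_imp_eq subsetD)
      finally show ?thesis by simp
    qed
    show "X = Y" using mem[OF _ X] mem[OF _ Y] X Y eq by auto
  qed
  define N where "N = Max ((\<lambda>X. \<Prod>X) ` Pow P)"
  have "(\<Prod>p\<in>P. 1 + real p powr s) = (\<Prod>p\<in>P. real p powr s + 1)" by (simp add: add.commute)
  also have "\<dots> = (\<Sum>X\<in>Pow P. \<Prod>p\<in>X. real p powr s)"
    by (subst prod_add[OF fin]) simp
  also have "\<dots> = (\<Sum>X\<in>Pow P. real (\<Prod>X) powr s)"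
    using prod_powr_distrib by (intro sum.cong refl) (simp add: of_nat_prod prod_powr_distrib)
  also have "\<dots> = (\<Sum>n\<in>(\<lambda>X. \<Prod>X) ` Pow P. real n powr s)"
    by (subst sum.reindex[OF inj]) simp
  also have "\<dots> \<le> (\<Sum>n=1..N. real n powr s)"
  proof (rule sum_mono2)
    show "(\<lambda>X. \<Prod>X) ` Pow P \<subseteq> {1..N}"
      using pos fin by (fastforce simp: N_def Suc_le_eq intro!: prod_pos Max_ge)
  qed auto
  finally show ?thesis by blast
qed

text \<open>Rankin's trick: raising the exponent from \<open>1\<close> to \<open>1 + 1 / ln x\<close> changes the product by a
  bounded factor and makes the full Dirichlet series available as an upper bound.\<close>

lemma prod_one_plus_inverse_prime_le:
  fixes x :: real
  assumes "x > 1"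
  shows "(\<Prod>p\<in>primes_le x. 1 + 1 / real p) \<le> exp 2 * (1 + ln x)"
proof -
  define u where "u = 1 / ln x"
  have u: "u > 0" using assms by (simp add: u_def)
  have fac: "1 + 1 / real p \<le> (1 + real p powr - (1 + u)) * exp (u * (ln (real p) / real p))"
    if "p \<in> primes_le x" for p
  proof -
    have p: "real p \<ge> 1" using that by (auto simp: primes_le_def prime_gt_0_nat Suc_le_eq)
    define a where "a = real p powr - (1 + u)"
    have a: "a = exp (- u * ln (real p)) / real p"
      using p unfolding a_def by (simp add: powr_def exp_diff exp_minus field_simps flip: exp_add)
    \<comment> \<open>Linearising p powr -u shows that shifting the exponent costs at most u * ln p
      / p per prime, a quantity whose sum over primes is already bounded.\<close>
    have "1 - u * ln (real p) \<le> exp (- u * ln (real p))"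
      using exp_ge_add_one_self[of "- u * ln (real p)"] by simp
    then have "(1 - u * ln (real p)) / real p \<le> a"
      unfolding a using p by (intro divide_right_mono) auto
    then have 1: "1 / real p \<le> a + u * (ln (real p) / real p)"
      by (simp add: diff_divide_distrib)
    have nn: "u * (ln (real p) / real p) \<ge> 0" "a \<ge> 0" using p u by (auto simp: a_def)
    have "1 + 1 / real p \<le> 1 + a + u * (ln (real p) / real p)" using 1 by simp
    also have "\<dots> \<le> (1 + a) * (1 + u * (ln (real p) / real p))"
      using mult_nonneg_nonneg[OF nn] by (simp only: distrib_left distrib_right mult_1_left mult_1_right mult.commute)
    also have "\<dots> \<le> (1 + a) * exp (u * (ln (real p) / real p))"
      using nn by (intro mult_left_mono exp_ge_add_one_self) auto
    finally show ?thesis by (simp add: a_def)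
  qed
  obtain N where N: "(\<Prod>p\<in>primes_le x. 1 + real p powr - (1 + u)) \<le> (\<Sum>n=1..N. real n powr - (1 + u))"
    using prod_one_plus_prime_powr_le[OF finite_primes_le, of x "- (1 + u)"]
    unfolding primes_le_def by blast
  have "(\<Prod>p\<in>primes_le x. 1 + 1 / real p)
     \<le> (\<Prod>p\<in>primes_le x. (1 + real p powr - (1 + u)) * exp (u * (ln (real p) / real p)))"
    using fac by (intro prod_mono) auto
  also have "\<dots> = (\<Prod>p\<in>primes_le x. 1 + real p powr - (1 + u)) *
                  exp (u * (\<Sum>p\<in>primes_le x. ln (real p) / real p))"
    by (simp add: prod.distrib exp_sum sum_distrib_left)
  \<comment> \<open>The choice u = 1 / ln x balances the two factors: the exponent becomes 2 and the
    Dirichlet sum is at most 1 + ln x.\<close>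
  also have "\<dots> \<le> (1 + 1 / u) * exp (u * (2 * ln x))"
    using N sum_powr_le[OF u, of N] sum_ln_prime_over_prime_le[of x] assms u
    by (intro mult_mono) (auto intro!: mult_left_mono)
  also have "\<dots> = exp 2 * (1 + ln x)"
    using assms by (simp add: u_def)
  finally show ?thesis .
qed

section \<open>Auxiliary identities and inequalities for finite sums and products\<close>

lemma sum_power_card_Pow:
  fixes y :: "'b::comm_semiring_1"
  assumes "finite W"
  shows "(\<Sum>S\<in>Pow W. y ^ card S) = (1 + y) ^ card W"
  using prod_add[OF assms, of "\<lambda>_. y" "\<lambda>_. 1"] by (simp add: add.commute)

lemma four_power: "(4::real) ^ m = 2 ^ m * 2 ^ m"
  by (simp flip: power_mult_distrib)

text \<open>Exchanging the factors one at a time, the exchange at i costs at most 1 times the other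
  factors, all bounded by the larger \<open>b\<close>. With \<open>a\<close> the rounded and
  \<open>b\<close> the exact quotients x / d, the omitted factor is what saves one power of
  x.\<close>

lemma abs_prod_diff_le:
  fixes a b :: "'a \<Rightarrow> real"
  assumes "finite V" "\<And>i. i \<in> V \<Longrightarrow> 0 \<le> a i" "\<And>i. i \<in> V \<Longrightarrow> a i \<le> b i"
    "\<And>i. i \<in> V \<Longrightarrow> b i - 1 \<le> a i"
  shows "\<bar>(\<Prod>i\<in>V. a i) - (\<Prod>i\<in>V. b i)\<bar> \<le> (\<Sum>i\<in>V. \<Prod>j\<in>V - {i}. b j)"
  using assms
proof (induction V rule: finite_induct)
  case (insert v V)
  have b: "\<And>i. i \<in> insert v V \<Longrightarrow> 0 \<le> b i" using insert.prems by force
  have le: "prod a V \<le> prod b V" using insert.prems by (intro prod_mono) auto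
  have nn: "0 \<le> prod a V" "0 \<le> prod b V" using insert.prems b by (auto intro!: prod_nonneg)
  have "\<bar>prod a (insert v V) - prod b (insert v V)\<bar>
      = \<bar>(a v - b v) * prod a V + b v * (prod a V - prod b V)\<bar>"
    using insert.hyps by (simp add: algebra_simps)
  also have "\<dots> \<le> 1 * prod b V + b v * \<bar>prod a V - prod b V\<bar>"
  proof -
    have "\<bar>a v - b v\<bar> \<le> 1" using insert.prems(2,3)[of v] by force
    then have "\<bar>(a v - b v) * prod a V\<bar> \<le> 1 * prod b V"
      unfolding abs_mult using le nn by (intro mult_mono) auto
    moreover have "\<bar>b v * (prod a V - prod b V)\<bar> = b v * \<bar>prod a V - prod b V\<bar>"
      using b by (simp add: abs_mult)
    ultimately show ?thesis by linarith
  qed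
  also have "\<dots> \<le> prod b V + b v * (\<Sum>i\<in>V. \<Prod>j\<in>V - {i}. b j)"
    using insert b by (simp add: mult_left_mono)
  also have "b v * (\<Sum>i\<in>V. \<Prod>j\<in>V - {i}. b j) = (\<Sum>i\<in>V. \<Prod>j\<in>insert v V - {i}. b j)"
    unfolding sum_distrib_left
  proof (rule sum.cong[OF refl])
    fix i assume "i \<in> V"
    then have "insert v V - {i} = insert v (V - {i})" using insert.hyps by auto
    then show "b v * (\<Prod>j\<in>V - {i}. b j) = (\<Prod>j\<in>insert v V - {i}. b j)"
      using insert.hyps by simp
  qed
  also have "prod b V + (\<Sum>i\<in>V. \<Prod>j\<in>insert v V - {i}. b j)
      = (\<Sum>i\<in>insert v V. \<Prod>j\<in>insert v V - {i}. b j)"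
    using insert.hyps by simp
  finally show ?case .
qed simp

text \<open>Telescoping with 1 / (y + 1)^2 \<le> 1 / y - 1 / (y + 1). The case N = 1 bounds the sum
  over all primes, and N = floor x bounds the tail of the Euler product.\<close>

lemma sum_inverse_squares_le:
  assumes "finite P" "\<And>p. p \<in> P \<Longrightarrow> p > N" "N > 0"
  shows "(\<Sum>p\<in>P. 1 / real p ^ 2) \<le> 1 / real N"
proof -
  have "(\<Sum>p\<in>{N<..N+d}. 1 / real p ^ 2) \<le> 1 / real N - 1 / real (N + d)" for d
  proof (induction d)
    case (Suc d)
    have eq: "{N<..N + Suc d} = insert (Suc (N + d)) {N<..N + d}" by auto
    define y where "y = real (N + d)"
    have y: "y > 0" using assms(3) by (simp add: y_def)
    have "1 / (1 + y) ^ 2 \<le> 1 / y - 1 / (1 + y)"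
    proof -
      have "1 / (1 + y) ^ 2 \<le> 1 / (y * (1 + y))"
        using y by (intro divide_left_mono) (auto simp: power2_eq_square)
      also have "\<dots> = 1 / y - 1 / (1 + y)" using y by (simp add: field_simps)
      finally show ?thesis .
    qed
    moreover have "real (Suc (N + d)) = 1 + y" "real (N + Suc d) = 1 + y" by (simp_all add: y_def)
    ultimately show ?case using Suc unfolding eq y_def[symmetric] by simp
  qed simp
  note * = this
  obtain M where M: "\<And>p. p \<in> P \<Longrightarrow> p \<le> M"
    using assms(1) by (meson finite_nat_set_iff_bounded_le)
  have "(\<Sum>p\<in>P. 1 / real p ^ 2) \<le> (\<Sum>p\<in>{N<..N+M}. 1 / real p ^ 2)"
    using assms M by (intro sum_mono2) (auto intro!: trans_le_add2)
  also have "\<dots> \<le> 1 / real N" by (rule order_trans[OF *]) simp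
  finally show ?thesis .
qed

subsection \<open>Tuples with prescribed divisibility patterns\<close>

text \<open>\<open>I\<close> prescribes which sets \<open>{i. p dvd n i}\<close> may occur for a tuple \<open>n\<close> and a prime \<open>p\<close>.\<close>

locale divisibility_pattern =
  fixes V :: "'a set" and I :: "'a set \<Rightarrow> bool"
  assumes finite_V: "finite V" and I_empty: "I {}" and I_single: "v \<in> V \<Longrightarrow> I {v}"
begin

section \<open>The Moebius inverse of the pattern indicator and the Euler factors\<close>

definition moebius :: "'a set \<Rightarrow> real" where
  "moebius S = (\<Sum>T\<in>Pow S. (- 1) ^ (card S - card T) * of_bool (I T))"

text \<open>The probability that a random subset of \<open>V\<close>, containing each element
  independently with probability q, satisfies \<open>I\<close>. At q = 1 / p it is the Euler factor
  of p.\<close>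

definition local_density :: "real \<Rightarrow> real" where
  "local_density q = (\<Sum>T\<in>Pow V. of_bool (I T) * (q ^ card T * (1 - q) ^ (card V - card T)))"

text \<open>After exchanging the sums over T \<subseteq> S, writing S = T \<union> R turns the inner
  sum into q ^ card T times the binomial expansion of a power of 1 - q. The case q = 1 is Moebius
  inversion, and U = V gives \<open>local_density\<close>.\<close>

lemma sum_moebius_power:
  assumes "finite U"
  shows "(\<Sum>S\<in>Pow U. moebius S * q ^ card S)
       = (\<Sum>T\<in>Pow U. of_bool (I T) * (q ^ card T * (1 - q) ^ (card U - card T)))"
proof -
  have inner: "(\<Sum>S\<in>{S\<in>Pow U. T \<subseteq> S}. (- 1) ^ (card S - card T) * q ^ card S)
      = q ^ card T * (1 - q) ^ (card U - card T)" if T: "T \<in> Pow U" for T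
  proof -
    have fT: "finite T" using T assms finite_subset by auto
    have img: "{S\<in>Pow U. T \<subseteq> S} = (\<lambda>R. T \<union> R) ` Pow (U - T)"
    proof (intro set_eqI iffI)
      fix S assume "S \<in> {S\<in>Pow U. T \<subseteq> S}"
      then show "S \<in> (\<lambda>R. T \<union> R) ` Pow (U - T)" by (intro image_eqI[of _ _ "S - T"]) auto
    qed (use T in auto)
    have inj: "inj_on (\<lambda>R. T \<union> R) (Pow (U - T))" by (auto simp: inj_on_def)
    have "(\<Sum>S\<in>{S\<in>Pow U. T \<subseteq> S}. (- 1) ^ (card S - card T) * q ^ card S)
        = (\<Sum>R\<in>Pow (U - T). (- 1) ^ (card (T \<union> R) - card T) * q ^ card (T \<union> R))"
      unfolding img by (subst sum.reindex[OF inj]) simp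
    also have "\<dots> = (\<Sum>R\<in>Pow (U - T). q ^ card T * (- q) ^ card R)"
    proof (rule sum.cong[OF refl])
      fix R assume R: "R \<in> Pow (U - T)"
      then have "finite R" using assms finite_subset by auto
      then have "card (T \<union> R) = card T + card R" using R fT by (intro card_Un_disjoint) auto
      then show "(- 1) ^ (card (T \<union> R) - card T) * q ^ card (T \<union> R) = q ^ card T * (- q) ^ card R"
        by (simp add: power_add power_minus[of q])
    qed
    also have "\<dots> = q ^ card T * (1 - q) ^ card (U - T)"
      using sum_power_card_Pow[of "U - T" "- q"] assms by (simp flip: sum_distrib_left)
    finally show ?thesis using T fT by (simp add: card_Diff_subset)
  qed
  have "(\<Sum>S\<in>Pow U. moebius S * q ^ card S)
      = (\<Sum>S\<in>Pow U. \<Sum>T\<in>{T\<in>Pow U. T \<subseteq> S}. (- 1) ^ (card S - card T) * of_bool (I T) * q ^ card S)"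
    unfolding moebius_def sum_distrib_right by (intro sum.cong) auto
  also have "\<dots> = (\<Sum>T\<in>Pow U. \<Sum>S\<in>{S\<in>Pow U. T \<subseteq> S}. (- 1) ^ (card S - card T) * of_bool (I T) * q ^ card S)"
    using assms by (intro sum.swap_restrict) auto
  also have "\<dots> = (\<Sum>T\<in>Pow U. of_bool (I T) * (\<Sum>S\<in>{S\<in>Pow U. T \<subseteq> S}. (- 1) ^ (card S - card T) * q ^ card S))"
    by (simp add: sum_distrib_left mult_ac)
  also have "\<dots> = (\<Sum>T\<in>Pow U. of_bool (I T) * (q ^ card T * (1 - q) ^ (card U - card T)))"
    using inner by simp
  finally show ?thesis .
qed

lemma sum_moebius:
  assumes "finite U"
  shows "(\<Sum>S\<in>Pow U. moebius S) = of_bool (I U)"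
proof -
  \<comment> \<open>At q = 1 the convention 0 ^ 0 = 1 singles out the term T = U.\<close>
  have z: "(0::real) ^ (card U - card T) = of_bool (T = U)" if "T \<subseteq> U" for T
    using that assms card_subset_eq[OF assms that] card_mono[OF assms that]
    by (cases "T = U") (auto simp: power_0_left)
  have "(\<Sum>S\<in>Pow U. moebius S) = (\<Sum>T\<in>Pow U. of_bool (I T) * (0 ^ (card U - card T)))"
    using sum_moebius_power[OF assms, of 1] by simp
  also have "\<dots> = (\<Sum>T\<in>Pow U. if T = U then of_bool (I U) else 0)"
    using z by (intro sum.cong refl) auto
  also have "\<dots> = of_bool (I U)" using assms by (subst sum.delta) auto
  finally show ?thesis .
qed

lemma moebius_empty [simp]: "moebius {} = 1"
  by (simp add: moebius_def I_empty)

lemma moebius_single: "v \<in> V \<Longrightarrow> moebius {v} = 0"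
  by (simp add: moebius_def Pow_insert I_empty I_single)

text \<open>The value is 1 - 1 - 1 plus the indicator of the pair, so it is 0 or -1. The constant 1
  matters: it multiplies the first-order term q and so fixes the power of the logarithm in the
  error.\<close>

lemma abs_moebius_pair_le: "\<lbrakk>v \<in> V; w \<in> V; v \<noteq> w\<rbrakk> \<Longrightarrow> \<bar>moebius {v, w}\<bar> \<le> 1"
proof -
  assume vw: "v \<in> V" "w \<in> V" "v \<noteq> w"
  define g where "g T = (- 1 :: real) ^ (card {v, w} - card T) * of_bool (I T)" for T
  have "Pow {v, w} = {{}, {v}, {w}, {v, w}}" by auto
  then have "moebius {v, w} = g {} + g {v} + g {w} + g {v, w}"
    unfolding moebius_def g_def[symmetric] using vw by (simp add: doubleton_eq_iff)
  then show ?thesis using vw by (simp add: g_def I_empty I_single)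
qed

lemma abs_moebius_le:
  assumes "S \<subseteq> V"
  shows "\<bar>moebius S\<bar> \<le> 2 ^ card V"
proof -
  have "\<bar>moebius S\<bar> \<le> (\<Sum>T\<in>Pow S. \<bar>(- 1) ^ (card S - card T) * of_bool (I T)\<bar>)"
    unfolding moebius_def by (rule sum_abs)
  also have "\<dots> \<le> (\<Sum>T\<in>Pow S. 1)" by (intro sum_mono) (auto simp: abs_mult power_abs)
  also have "\<dots> = 2 ^ card S" using finite_subset[OF assms finite_V] by (simp add: card_Pow)
  also have "\<dots> \<le> (2::real) ^ card V" using assms finite_V by (intro power_increasing card_mono) auto
  finally show ?thesis .
qed

lemma local_density_eq: "local_density q = (\<Sum>S\<in>Pow V. moebius S * q ^ card S)"
  unfolding local_density_def using sum_moebius_power[OF finite_V] by simp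

lemma local_density_le_1:
  assumes "0 \<le> q" "q \<le> 1"
  shows "local_density q \<le> 1"
proof -
  have "local_density q \<le> (\<Sum>T\<in>Pow V. q ^ card T * (1 - q) ^ (card V - card T))"
    unfolding local_density_def using assms by (intro sum_mono) auto
  also have "\<dots> = (\<Prod>_\<in>V. q + (1 - q))"
    unfolding prod_add[OF finite_V] using finite_V
    by (intro sum.cong) (auto simp: card_Diff_subset finite_subset)
  finally show ?thesis by simp
qed

lemma local_density_nonneg:
  assumes "0 \<le> q" "q \<le> 1"
  shows "local_density q \<ge> 0"
  unfolding local_density_def using assms by (intro sum_nonneg) auto

text \<open>The empty set contributes 1 and singletons contribute 0, so only sets of size at least 2
  remain. The quadratic order in q makes the Euler product converge.\<close>

lemma one_minus_local_density_le:
  assumes "0 \<le> q" "q \<le> 1"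
  shows "1 - local_density q \<le> 4 ^ card V * q\<^sup>2"
proof -
  have "local_density q - 1 = (\<Sum>S\<in>Pow V - {{}}. moebius S * q ^ card S)"
    unfolding local_density_eq using finite_V by (subst sum.remove[of _ "{}"]) auto
  then have "1 - local_density q = (\<Sum>S\<in>Pow V - {{}}. - (moebius S * q ^ card S))"
    by (simp add: sum_negf)
  also have "\<dots> \<le> (\<Sum>S\<in>Pow V - {{}}. 2 ^ card V * q\<^sup>2)"
  proof (rule sum_mono)
    fix S assume S: "S \<in> Pow V - {{}}"
    show "- (moebius S * q ^ card S) \<le> 2 ^ card V * q\<^sup>2"
    proof (cases "card S \<ge> 2")
      case True
      have "- (moebius S * q ^ card S) \<le> \<bar>moebius S * q ^ card S\<bar>"
        by (rule abs_ge_minus_self)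
      also have "\<dots> = \<bar>moebius S\<bar> * q ^ card S"
        using assms by (simp add: abs_mult)
      also have "\<dots> \<le> 2 ^ card V * q\<^sup>2"
        using assms S True by (intro mult_mono abs_moebius_le power_decreasing) auto
      finally show ?thesis .
    next
      case False
      have "finite S" "S \<noteq> {}" using S finite_V finite_subset by auto
      then have "card S = 1" using False by (metis One_nat_def card_0_eq less_2_cases not_le)
      then obtain v where "S = {v}" by (auto simp: card_1_singleton_iff)
      then show ?thesis using S moebius_single by simp
    qed
  qed
  also have "\<dots> \<le> (\<Sum>S\<in>Pow V. 2 ^ card V * q\<^sup>2)"
    using finite_V by (intro sum_mono2) auto
  also have "\<dots> = 4 ^ card V * q\<^sup>2"
    using finite_V by (simp add: card_Pow four_power)
  finally show ?thesis .
qed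

text \<open>The pairs containing \<open>i\<close> are the only sets contributing to first order.\<close>

lemma sum_abs_moebius_except_le:
  assumes i: "i \<in> V" and q: "0 \<le> q" "q \<le> 1"
  shows "(\<Sum>S\<in>Pow V. \<bar>moebius S\<bar> * q ^ card (S - {i})) \<le> (1 + q) ^ (card V - 1) * (1 + 4 ^ card V * q\<^sup>2)"
proof -
  define D where "D = (\<lambda>j. {i, j}) ` (V - {i})"
  have inj: "inj_on (\<lambda>j. {i, j}) (V - {i})" by (auto simp: inj_on_def doubleton_eq_iff)
  have D: "D \<subseteq> Pow V" using i by (auto simp: D_def)
  have fD: "finite D" using finite_V by (simp add: D_def)
  have bound: "\<bar>moebius S\<bar> * q ^ card (S - {i})
      \<le> of_bool (S = {}) + of_bool (S \<in> D) * q + 2 ^ card V * q\<^sup>2" if S: "S \<in> Pow V" for S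
  proof -
    have fS: "finite S" using S finite_V finite_subset by auto
    \<comment> \<open>If S - {i} has exactly one element, S is either a pair through i or a
      singleton avoiding i; all singletons have \<open>moebius\<close> value 0.\<close>
    consider "S = {}" | v where "S = {v}" | "S \<in> D" | "card (S - {i}) \<ge> 2"
    proof (cases "card (S - {i}) \<ge> 2")
      case False
      show ?thesis
      proof (cases "S - {i} = {}")
        case True
        then show ?thesis using that by blast
      next
        case ne: False
        then have "card (S - {i}) = 1" using False fS
          by (metis One_nat_def card_0_eq finite_Diff less_2_cases not_le)
        then obtain j where j: "S - {i} = {j}" by (auto simp: card_1_singleton_iff)
        show ?thesis
        proof (cases "i \<in> S")
          case True
          then have "S = {i, j}" using j by auto
          moreover have "j \<in> V - {i}" using j S by auto
          ultimately show ?thesis using that unfolding D_def by blast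
        next
          case False
          then show ?thesis using that j by auto
        qed
      qed
    qed (use that in blast)
    then show ?thesis
    proof cases
      case 2
      then show ?thesis using S q moebius_single by simp
    next
      case 3
      then obtain j where j: "S = {i, j}" "j \<in> V" "j \<noteq> i" by (auto simp: D_def)
      then have "S - {i} = {j}" by auto
      then have "\<bar>moebius S\<bar> * q ^ card (S - {i}) \<le> 1 * q"
        using j i q abs_moebius_pair_le[of i j] by (simp add: mult_left_le_one_le)
      then show ?thesis using 3 q by (simp add: add_increasing add_increasing2)
    next
      case 4
      have "\<bar>moebius S\<bar> * q ^ card (S - {i}) \<le> 2 ^ card V * q\<^sup>2"
        using q S 4 by (intro mult_mono abs_moebius_le power_decreasing) auto
      then show ?thesis using q by (simp add: add_increasing)
    qed (use q in simp)
  qed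
  have "(\<Sum>S\<in>Pow V. \<bar>moebius S\<bar> * q ^ card (S - {i}))
     \<le> (\<Sum>S\<in>Pow V. of_bool (S = {}) + of_bool (S \<in> D) * q + 2 ^ card V * q\<^sup>2)"
    using bound by (rule sum_mono)
  also have "\<dots> = 1 + real (card V - 1) * q + 4 ^ card V * q\<^sup>2"
  proof -
    have "(\<Sum>S\<in>Pow V. of_bool (S = {}) :: real) = (\<Sum>S\<in>{{} :: 'a set}. 1)"
      using finite_V by (intro sum.mono_neutral_cong_right) auto
    moreover have "(\<Sum>S\<in>Pow V. of_bool (S \<in> D) * q) = (\<Sum>S\<in>D. q)"
      using finite_V D by (intro sum.mono_neutral_cong_right) auto
    moreover have "card D = card V - 1"
      unfolding D_def using inj finite_V i by (simp add: card_image)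
    ultimately show ?thesis
      using finite_V by (simp add: sum.distrib card_Pow four_power)
  qed
  \<comment> \<open>Bernoulli's inequality gives the first-order part the shape of a power of 1 + q,
    so that the product over primes can be bounded by a power of the Mertens product.\<close>
  also have "\<dots> \<le> (1 + q) ^ (card V - 1) + 4 ^ card V * q\<^sup>2"
    using Bernoulli_inequality[of q "card V - 1"] q by simp
  also have "\<dots> \<le> (1 + q) ^ (card V - 1) * (1 + 4 ^ card V * q\<^sup>2)"
    using mult_right_mono[of 1 "(1 + q) ^ (card V - 1)" "4 ^ card V * q\<^sup>2"] q
    by (simp add: distrib_left)
  finally show ?thesis .
qed

section \<open>Exact expansion of the count and its rounding error\<close>

definition tuples_le :: "real \<Rightarrow> ('a \<Rightarrow> nat) set" where
  "tuples_le x = V \<rightarrow>\<^sub>E {m. 1 \<le> m \<and> real m \<le> x}"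

definition respects_pattern :: "('a \<Rightarrow> nat) \<Rightarrow> bool" where
  "respects_pattern n \<longleftrightarrow> (\<forall>p. prime p \<longrightarrow> I {i\<in>V. p dvd n i})"

definition count :: "real \<Rightarrow> real" where
  "count x = (\<Sum>n\<in>tuples_le x. of_bool (respects_pattern n))"

definition prime_part :: "nat set \<Rightarrow> (nat \<Rightarrow> 'a set) \<Rightarrow> 'a \<Rightarrow> nat" where
  "prime_part P T i = \<Prod>{p\<in>P. i \<in> T p}"

lemma finite_tuples_le [simp]: "finite (tuples_le x)"
  unfolding tuples_le_def using finite_V
  by (intro finite_PiE finite_subset[OF _ finite_nat_le_real[of x]]) auto

text \<open>Each term on the right factors over the coordinates of n, so that summing over all
  tuples reduces to counting multiples in each coordinate separately.\<close>

lemma of_bool_respects_pattern: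
  assumes n: "n \<in> tuples_le x"
  shows "of_bool (respects_pattern n) =
    (\<Sum>T\<in>primes_le x \<rightarrow>\<^sub>E Pow V. (\<Prod>p\<in>primes_le x. moebius (T p)) *
       (\<Prod>i\<in>V. of_bool (prime_part (primes_le x) T i dvd n i)))"
proof -
  let ?P = "primes_le x"
  have "respects_pattern n \<longleftrightarrow> (\<forall>p\<in>?P. I {i\<in>V. p dvd n i})"
    unfolding respects_pattern_def
  proof safe
    fix p :: nat assume *: "\<forall>p\<in>?P. I {i\<in>V. p dvd n i}" and p: "prime p"
    show "I {i\<in>V. p dvd n i}"
    proof (cases "p \<in> ?P")
      \<comment> \<open>A prime above x divides no positive integer up to x, so its divisibility
        pattern is empty and hence allowed.\<close>
      case False
      then have "\<not> p dvd n i" if "i \<in> V" for i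
        using that n p dvd_imp_le[of p "n i"]
        by (force simp: tuples_le_def primes_le_def PiE_iff)
      then have empty: "{i\<in>V. p dvd n i} = {}" by auto
      show ?thesis unfolding empty by (rule I_empty)
    qed (use * in auto)
  qed (auto simp: primes_le_def)
  then have "of_bool (respects_pattern n) = (\<Prod>p\<in>?P. of_bool (I {i\<in>V. p dvd n i}) :: real)"
    by (cases "\<forall>p\<in>?P. I {i\<in>V. p dvd n i}") (auto simp: prod_zero_iff)
  also have "\<dots> = (\<Prod>p\<in>?P. \<Sum>S\<in>Pow V. moebius S * of_bool (\<forall>i\<in>S. p dvd n i))"
  proof (rule prod.cong[OF refl])
    fix p
    have "of_bool (I {i\<in>V. p dvd n i}) = (\<Sum>S\<in>Pow {i\<in>V. p dvd n i}. moebius S)"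
      using finite_V by (subst sum_moebius) auto
    also have "\<dots> = (\<Sum>S\<in>Pow V. moebius S * of_bool (\<forall>i\<in>S. p dvd n i))"
      using finite_V by (intro sum.mono_neutral_cong_left) auto
    finally show "of_bool (I {i\<in>V. p dvd n i}) = \<dots>" .
  qed
  also have "\<dots> = (\<Sum>T\<in>?P \<rightarrow>\<^sub>E Pow V. \<Prod>p\<in>?P. moebius (T p) * of_bool (\<forall>i\<in>T p. p dvd n i))"
    using finite_V by (subst prod_sum_PiE) auto
  also have "\<dots> = (\<Sum>T\<in>?P \<rightarrow>\<^sub>E Pow V. (\<Prod>p\<in>?P. moebius (T p)) *
       (\<Prod>i\<in>V. of_bool (prime_part ?P T i dvd n i)))"
  proof (rule sum.cong[OF refl])
    fix T assume T: "T \<in> ?P \<rightarrow>\<^sub>E Pow V"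
    have dvd: "prime_part ?P T i dvd n i \<longleftrightarrow> (\<forall>p\<in>?P. i \<in> T p \<longrightarrow> p dvd n i)" for i
    proof -
      have "finite {p\<in>?P. i \<in> T p}" by simp
      then show ?thesis
        unfolding prime_part_def by (subst prod_primes_dvd_iff) (auto simp: primes_le_def)
    qed
    have "(\<Prod>p\<in>?P. of_bool (\<forall>i\<in>T p. p dvd n i) :: real) = of_bool (\<forall>p\<in>?P. \<forall>i\<in>T p. p dvd n i)"
      by (induction rule: finite_induct[OF finite_primes_le[of x]]) auto
    \<comment> \<open>Regroups the conditions by coordinate instead of by prime, using
      \<open>T p\<close> \<subseteq> \<open>V\<close>.\<close>
    also have "(\<forall>p\<in>?P. \<forall>i\<in>T p. p dvd n i) \<longleftrightarrow> (\<forall>i\<in>V. prime_part ?P T i dvd n i)"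
      unfolding dvd using T by (fastforce simp: PiE_iff)
    also have "of_bool (\<forall>i\<in>V. prime_part ?P T i dvd n i)
        = (\<Prod>i\<in>V. of_bool (prime_part ?P T i dvd n i) :: real)"
      by (induction rule: finite_induct[OF finite_V]) auto
    finally show "(\<Prod>p\<in>?P. moebius (T p) * of_bool (\<forall>i\<in>T p. p dvd n i)) =
        (\<Prod>p\<in>?P. moebius (T p)) * (\<Prod>i\<in>V. of_bool (prime_part ?P T i dvd n i))"
      by (simp add: prod.distrib)
  qed
  finally show ?thesis .
qed

lemma count_eq:
  "count x = (\<Sum>T\<in>primes_le x \<rightarrow>\<^sub>E Pow V. (\<Prod>p\<in>primes_le x. moebius (T p)) *
     (\<Prod>i\<in>V. real (card {m. 1 \<le> m \<and> real m \<le> x \<and> prime_part (primes_le x) T i dvd m})))"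
proof -
  let ?P = "primes_le x"
  have fin: "finite {m::nat. 1 \<le> m \<and> real m \<le> x}"
    by (rule finite_subset[OF _ finite_nat_le_real[of x]]) auto
  have "count x = (\<Sum>n\<in>tuples_le x. \<Sum>T\<in>?P \<rightarrow>\<^sub>E Pow V. (\<Prod>p\<in>?P. moebius (T p)) *
       (\<Prod>i\<in>V. of_bool (prime_part ?P T i dvd n i)))"
    unfolding count_def by (intro sum.cong refl of_bool_respects_pattern)
  also have "\<dots> = (\<Sum>T\<in>?P \<rightarrow>\<^sub>E Pow V. (\<Prod>p\<in>?P. moebius (T p)) *
       (\<Sum>n\<in>tuples_le x. \<Prod>i\<in>V. of_bool (prime_part ?P T i dvd n i)))"
    by (subst sum.swap) (simp add: sum_distrib_left)
  also have "\<dots> = (\<Sum>T\<in>?P \<rightarrow>\<^sub>E Pow V. (\<Prod>p\<in>?P. moebius (T p)) *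
     (\<Prod>i\<in>V. real (card {m. 1 \<le> m \<and> real m \<le> x \<and> prime_part ?P T i dvd m})))"
  proof (intro sum.cong refl arg_cong2[where f = "(*)"])
    fix T
    have "(\<Sum>n\<in>tuples_le x. \<Prod>i\<in>V. of_bool (prime_part ?P T i dvd n i) :: real) =
       (\<Prod>i\<in>V. \<Sum>m\<in>{m. 1 \<le> m \<and> real m \<le> x}. of_bool (prime_part ?P T i dvd m))"
      unfolding tuples_le_def using finite_V fin by (subst prod_sum_PiE) auto
    also have "\<dots> = (\<Prod>i\<in>V. real (card {m. 1 \<le> m \<and> real m \<le> x \<and> prime_part ?P T i dvd m}))"
      using fin by (intro prod.cong refl) (simp add: Int_def conj_assoc)
    finally show "(\<Sum>n\<in>tuples_le x. \<Prod>i\<in>V. of_bool (prime_part ?P T i dvd n i) :: real) = \<dots>" .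
  qed
  finally show ?thesis .
qed

text \<open>Exchanging the two products, p occurs once for each coordinate in \<open>T p\<close>
  \<inter> \<open>W\<close>. The main term uses W = V and the error term W = V - {i}.\<close>

lemma prod_div_prime_part:
  assumes "W \<subseteq> V" "finite P" "T \<in> P \<rightarrow>\<^sub>E Pow V"
  shows "(\<Prod>i\<in>W. x / real (prime_part P T i)) = x ^ card W * (\<Prod>p\<in>P. (1 / real p) ^ card (T p \<inter> W))"
proof -
  have fW: "finite W" using finite_subset[OF assms(1) finite_V] .
  have "(\<Prod>i\<in>W. x / real (prime_part P T i)) = x ^ card W * (\<Prod>i\<in>W. 1 / real (prime_part P T i))"
    by (simp add: prod_dividef)
  also have "(\<Prod>i\<in>W. 1 / real (prime_part P T i)) = (\<Prod>i\<in>W. \<Prod>p\<in>{p\<in>P. i \<in> T p}. 1 / real p)"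
    unfolding prime_part_def by (simp add: prod_dividef of_nat_prod)
  also have "\<dots> = (\<Prod>p\<in>P. \<Prod>i\<in>{i\<in>W. i \<in> T p}. 1 / real p)"
    using fW assms(2) by (rule prod.swap_restrict)
  also have "\<dots> = (\<Prod>p\<in>P. (1 / real p) ^ card (T p \<inter> W))"
    by (intro prod.cong refl) (simp add: Int_def conj_commute power_divide)
  finally show ?thesis .
qed

lemma count_minus_main_term_le:
  assumes x: "x \<ge> 0"
  shows "\<bar>count x - x ^ card V * (\<Prod>p\<in>primes_le x. local_density (1 / real p))\<bar>
    \<le> x ^ (card V - 1) *
       (\<Sum>i\<in>V. \<Prod>p\<in>primes_le x. \<Sum>S\<in>Pow V. \<bar>moebius S\<bar> * (1 / real p) ^ card (S - {i}))"
proof -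
  let ?P = "primes_le x"
  let ?F = "?P \<rightarrow>\<^sub>E Pow V"
  have pos: "p > 0" if "p \<in> ?P" for p using that by (auto simp: primes_le_def prime_gt_0_nat)
  define c where "c T i = real (card {m. 1 \<le> m \<and> real m \<le> x \<and> prime_part ?P T i dvd m})" for T i
  define b where "b T i = x / real (prime_part ?P T i)" for T i
  have ppos: "prime_part ?P T i > 0" for T i
    unfolding prime_part_def using pos by (intro prod_pos) auto
  have main: "x ^ card V * (\<Prod>p\<in>?P. local_density (1 / real p))
      = (\<Sum>T\<in>?F. (\<Prod>p\<in>?P. moebius (T p)) * (\<Prod>i\<in>V. b T i))"
  proof -
    have "(\<Prod>p\<in>?P. local_density (1 / real p))
        = (\<Sum>T\<in>?F. \<Prod>p\<in>?P. moebius (T p) * (1 / real p) ^ card (T p))"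
      unfolding local_density_eq using finite_V by (subst prod_sum_PiE) auto
    also have "x ^ card V * \<dots> = (\<Sum>T\<in>?F. (\<Prod>p\<in>?P. moebius (T p)) * (\<Prod>i\<in>V. b T i))"
      unfolding sum_distrib_left
    proof (rule sum.cong[OF refl])
      fix T assume T: "T \<in> ?F"
      have "T p \<inter> V = T p" if "p \<in> ?P" for p using T that by auto
      then have "(\<Prod>i\<in>V. b T i) = x ^ card V * (\<Prod>p\<in>?P. (1 / real p) ^ card (T p))"
        unfolding b_def using T by (subst prod_div_prime_part) auto
      then show "x ^ card V * (\<Prod>p\<in>?P. moebius (T p) * (1 / real p) ^ card (T p))
          = (\<Prod>p\<in>?P. moebius (T p)) * (\<Prod>i\<in>V. b T i)"
        by (simp add: prod.distrib)
    qed
    finally show ?thesis .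
  qed
  have "\<bar>count x - x ^ card V * (\<Prod>p\<in>?P. local_density (1 / real p))\<bar>
      = \<bar>\<Sum>T\<in>?F. (\<Prod>p\<in>?P. moebius (T p)) * ((\<Prod>i\<in>V. c T i) - (\<Prod>i\<in>V. b T i))\<bar>"
    unfolding main count_eq c_def by (simp add: sum_subtractf right_diff_distrib)
  also have "\<dots> \<le> (\<Sum>T\<in>?F. \<bar>(\<Prod>p\<in>?P. moebius (T p)) * ((\<Prod>i\<in>V. c T i) - (\<Prod>i\<in>V. b T i))\<bar>)"
    by (rule sum_abs)
  also have "\<dots> \<le> (\<Sum>T\<in>?F. (\<Prod>p\<in>?P. \<bar>moebius (T p)\<bar>) * (\<Sum>i\<in>V. \<Prod>j\<in>V - {i}. b T j))"
    unfolding abs_mult abs_prod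
    using card_multiples_le_bounds[OF ppos x] finite_V
    by (intro sum_mono mult_left_mono abs_prod_diff_le) (auto simp: b_def c_def intro!: prod_nonneg)
  also have "\<dots> = (\<Sum>T\<in>?F. \<Sum>i\<in>V. x ^ (card V - 1) *
      (\<Prod>p\<in>?P. \<bar>moebius (T p)\<bar> * (1 / real p) ^ card (T p - {i})))"
    unfolding sum_distrib_left
  proof (intro sum.cong refl)
    fix T i assume T: "T \<in> ?F" and i: "i \<in> V"
    have "T p \<inter> (V - {i}) = T p - {i}" if "p \<in> ?P" for p using T that by auto
    then have "(\<Prod>j\<in>V - {i}. b T j) = x ^ (card V - 1) * (\<Prod>p\<in>?P. (1 / real p) ^ card (T p - {i}))"
      unfolding b_def using T i finite_V by (subst prod_div_prime_part) auto
    then show "(\<Prod>p\<in>?P. \<bar>moebius (T p)\<bar>) * (\<Prod>j\<in>V - {i}. b T j) = x ^ (card V - 1) *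
      (\<Prod>p\<in>?P. \<bar>moebius (T p)\<bar> * (1 / real p) ^ card (T p - {i}))"
      by (simp add: prod.distrib)
  qed
  also have "\<dots> = x ^ (card V - 1) *
      (\<Sum>i\<in>V. \<Sum>T\<in>?F. \<Prod>p\<in>?P. \<bar>moebius (T p)\<bar> * (1 / real p) ^ card (T p - {i}))"
    by (subst sum.swap) (simp add: sum_distrib_left)
  \<comment> \<open>Taking absolute values kept every summand a product over primes, so the sum over
    all \<open>T\<close> refolds into an Euler product.\<close>
  also have "\<dots> = x ^ (card V - 1) *
       (\<Sum>i\<in>V. \<Prod>p\<in>?P. \<Sum>S\<in>Pow V. \<bar>moebius S\<bar> * (1 / real p) ^ card (S - {i}))"
    using finite_V by (subst prod_sum_PiE) auto
  finally show ?thesis .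
qed

lemma error_product_le:
  assumes i: "i \<in> V" and x: "x \<ge> exp 1"
  shows "(\<Prod>p\<in>primes_le x. \<Sum>S\<in>Pow V. \<bar>moebius S\<bar> * (1 / real p) ^ card (S - {i}))
    \<le> (2 * exp 2) ^ (card V - 1) * exp (4 ^ card V) * ln x ^ (card V - 1)"
proof -
  let ?P = "primes_le x"
  have x1: "x > 1" using x exp_gt_one[of 1] by linarith
  have lnx: "ln x \<ge> 1" using x x1 ln_ge_iff by auto
  have p1: "p > 1" if "p \<in> ?P" for p using that prime_gt_1_nat by (simp add: primes_le_def)
  have "(\<Prod>p\<in>?P. \<Sum>S\<in>Pow V. \<bar>moebius S\<bar> * (1 / real p) ^ card (S - {i}))
     \<le> (\<Prod>p\<in>?P. (1 + 1 / real p) ^ (card V - 1) * (1 + 4 ^ card V * (1 / real p)\<^sup>2))"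
  proof (intro prod_mono conjI sum_nonneg)
    fix p assume "p \<in> ?P"
    then have "1 / real p \<le> 1" using p1[of p] by simp
    then show "(\<Sum>S\<in>Pow V. \<bar>moebius S\<bar> * (1 / real p) ^ card (S - {i}))
        \<le> (1 + 1 / real p) ^ (card V - 1) * (1 + 4 ^ card V * (1 / real p)\<^sup>2)"
      by (intro sum_abs_moebius_except_le i) auto
  qed auto
  also have "\<dots> = (\<Prod>p\<in>?P. 1 + 1 / real p) ^ (card V - 1) * (\<Prod>p\<in>?P. 1 + 4 ^ card V * (1 / real p)\<^sup>2)"
    by (simp add: prod.distrib prod_power_distrib)
  also have "\<dots> \<le> (exp 2 * (2 * ln x)) ^ (card V - 1) * exp (4 ^ card V)"
  proof (intro mult_mono power_mono)
    have "(\<Prod>p\<in>?P. 1 + 1 / real p) \<le> exp 2 * (1 + ln x)"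
      using x1 by (rule prod_one_plus_inverse_prime_le)
    also have "\<dots> \<le> exp 2 * (2 * ln x)" using lnx by simp
    finally show "(\<Prod>p\<in>?P. 1 + 1 / real p) \<le> exp 2 * (2 * ln x)" .
    \<comment> \<open>By 1 + z \<le> exp z this product is bounded independently of x, since the
      inverse squares of the primes sum to at most 1.\<close>
    have "(\<Prod>p\<in>?P. 1 + 4 ^ card V * (1 / real p)\<^sup>2) \<le> (\<Prod>p\<in>?P. exp (4 ^ card V * (1 / real p)\<^sup>2))"
      by (intro prod_mono) (auto intro: add_nonneg_nonneg)
    also have "\<dots> = exp (4 ^ card V * (\<Sum>p\<in>?P. 1 / real p ^ 2))"
      by (simp add: exp_sum sum_distrib_left power_one_over)
    also have "\<dots> \<le> exp (4 ^ card V * 1)"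
      using sum_inverse_squares_le[of ?P 1] p1 by (intro iffD2[OF exp_le_cancel_iff] mult_left_mono) auto
    finally show "(\<Prod>p\<in>?P. 1 + 4 ^ card V * (1 / real p)\<^sup>2) \<le> exp (4 ^ card V)" by simp
  qed (use lnx in \<open>auto intro!: prod_nonneg add_nonneg_nonneg\<close>)
  also have "\<dots> = (2 * exp 2) ^ (card V - 1) * exp (4 ^ card V) * ln x ^ (card V - 1)"
    by (simp add: power_mult_distrib mult_ac)
  finally show ?thesis .
qed

section \<open>Convergence of the Euler product and asymptotics of the count\<close>

definition density :: real where
  "density = (\<Prod>p. if prime p then local_density (1 / real p) else 1)"

text \<open>All factors lie in [0, 1], so dropping those beyond x changes the product by at most the
  sum of their distances from 1, which is O(1 / x). The bound holds for every longer partial product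
  and passes to the limit.\<close>

lemma local_product_minus_density_le:
  assumes x: "x \<ge> 1"
  shows "\<bar>(\<Prod>p\<in>primes_le x. local_density (1 / real p)) - density\<bar> \<le> 2 * 4 ^ card V / x"
proof -
  define g where "g p = (if prime p then local_density (1 / real p) else 1)" for p :: nat
  define N where "N = nat \<lfloor>x\<rfloor>"
  have "N \<ge> 1" using x by (simp add: N_def le_nat_iff le_floor_iff)
  moreover have "x < real N + 1" using x unfolding N_def by linarith
  \<comment> \<open>The factor 2 converts the tail bound 1 / N at N = floor x into 2 / x.\<close>
  ultimately have N: "N \<ge> 1" "x \<le> 2 * real N" by linarith+
  have pr: "0 \<le> 1 / real p" "1 / real p \<le> 1" if "prime p" for p
    using prime_gt_0_nat[OF that] by auto
  have g: "0 \<le> g p" "g p \<le> 1" "1 - g p \<le> 4 ^ card V * (1 / real p ^ 2)" for p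
    using local_density_nonneg[OF pr] local_density_le_1[OF pr] one_minus_local_density_le[OF pr]
    by (auto simp: g_def power_one_over)
  have "summable (\<lambda>p. 4 ^ card V * (1 / real p ^ 2))"
    using inverse_power_summable[of 2, where 'a = real] by (intro summable_mult) (simp add: inverse_eq_divide)
  then have "summable (\<lambda>p. norm (g p - 1))"
    by (rule summable_comparison_test') (use g in auto)
  then have "convergent_prod g"
    by (intro abs_convergent_prod_imp_convergent_prod summable_imp_abs_convergent_prod)
  then have lim: "(\<lambda>n. prod g {..n}) \<longlonglongrightarrow> density"
    unfolding density_def g_def[symmetric] by (rule convergent_prod_LIMSEQ)
  have "prod g {..N} = prod g (primes_le x)"
    by (rule prod.mono_neutral_right) (use x in \<open>auto simp: primes_le_def N_def g_def le_nat_iff le_floor_iff\<close>)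
  then have eq: "(\<Prod>p\<in>primes_le x. local_density (1 / real p)) = prod g {..N}"
    by (simp add: g_def primes_le_def)
  have "\<bar>prod g {..N} - prod g {..n}\<bar> \<le> 2 * 4 ^ card V / x" if "n \<ge> N" for n
  proof -
    have "{..n} = {..N} \<union> {N<..n}" using that by auto
    then have split: "prod g {..n} = prod g {..N} * prod g {N<..n}"
      by (simp only:) (subst prod.union_disjoint, auto)
    \<comment> \<open>Weierstrass' inequality: a product of factors 1 - a with a in [0, 1] is at
      least 1 minus the sum of the a.\<close>
    have "1 - prod g {N<..n} \<le> (\<Sum>p\<in>{N<..n}. 1 - g p)"
      using Weierstrass_prod_ineq[of "{N<..n}" "\<lambda>p. 1 - g p"] g by simp
    also have "\<dots> \<le> (\<Sum>p\<in>{N<..n}. 4 ^ card V * (1 / real p ^ 2))"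
      using g by (intro sum_mono)
    also have "\<dots> \<le> 4 ^ card V * (1 / real N)"
      unfolding sum_distrib_left[symmetric] using N
      by (intro mult_left_mono sum_inverse_squares_le) auto
    also have "\<dots> \<le> 4 ^ card V * (2 / x)"
      using N x by (intro mult_left_mono) (auto simp: field_simps)
    finally have 1: "1 - prod g {N<..n} \<le> 2 * 4 ^ card V / x" by (simp add: mult.commute)
    have 2: "0 \<le> prod g {..N}" "prod g {..N} \<le> 1" "prod g {N<..n} \<le> 1"
      using g by (auto intro!: prod_nonneg prod_le_1)
    have "\<bar>prod g {..N} - prod g {..n}\<bar> = prod g {..N} * (1 - prod g {N<..n})"
    proof -
      have "prod g {..N} - prod g {..n} = prod g {..N} * (1 - prod g {N<..n})"
        by (simp add: split algebra_simps)
      then show ?thesis using 2 by (simp add: abs_mult)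
    qed
    also have "\<dots> \<le> 1 - prod g {N<..n}" using 2 by (simp add: mult_left_le_one_le)
    finally show ?thesis using 1 by linarith
  qed
  then have "eventually (\<lambda>n. \<bar>prod g {..N} - prod g {..n}\<bar> \<le> 2 * 4 ^ card V / x) sequentially"
    by (rule eventually_sequentiallyI)
  moreover have "(\<lambda>n. \<bar>prod g {..N} - prod g {..n}\<bar>) \<longlonglongrightarrow> \<bar>prod g {..N} - density\<bar>"
    by (intro tendsto_intros lim)
  ultimately show ?thesis unfolding eq by (intro tendsto_upperbound) auto
qed

text \<open>Two errors add up: rounding, and truncation of the Euler product. The latter is only O(x
  ^ (card V - 1)) and is absorbed because ln x \<ge> 1 for x \<ge> exp 1.\<close>

theorem count_asymptotics:
  assumes "V \<noteq> {}"
  shows "(\<lambda>x. count x - density * x ^ card V) \<in> O[at_top](\<lambda>x. x ^ (card V - 1) * ln x ^ (card V - 1))"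
proof -
  let ?k = "card V"
  define A where "A = real ?k * ((2 * exp 2) ^ (?k - 1) * exp (4 ^ ?k))"
  have "\<bar>count x - density * x ^ ?k\<bar> \<le> (A + 2 * 4 ^ ?k) * \<bar>x ^ (?k - 1) * ln x ^ (?k - 1)\<bar>"
    if x: "x \<ge> exp 1" for x
  proof -
    let ?Q = "\<Prod>p\<in>primes_le x. local_density (1 / real p)"
    have x1: "x > 1" using x exp_gt_one[of 1] by linarith
    have "ln x \<ge> 1" using x x1 ln_ge_iff by auto
    then have lnx: "ln x ^ (?k - 1) \<ge> 1" by (rule one_le_power)
    have "\<bar>count x - x ^ ?k * ?Q\<bar> \<le> x ^ (?k - 1) *
       (\<Sum>i\<in>V. \<Prod>p\<in>primes_le x. \<Sum>S\<in>Pow V. \<bar>moebius S\<bar> * (1 / real p) ^ card (S - {i}))"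
      using x1 by (intro count_minus_main_term_le) auto
    also have "\<dots> \<le> x ^ (?k - 1) *
       (\<Sum>i\<in>V. (2 * exp 2) ^ (?k - 1) * exp (4 ^ ?k) * ln x ^ (?k - 1))"
      using x x1 by (intro mult_left_mono sum_mono error_product_le) auto
    finally have 1: "\<bar>count x - x ^ ?k * ?Q\<bar> \<le> A * (x ^ (?k - 1) * ln x ^ (?k - 1))"
      by (simp add: A_def mult_ac)
    have "\<bar>x ^ ?k * ?Q - density * x ^ ?k\<bar> = x ^ ?k * \<bar>?Q - density\<bar>"
    proof -
      have "x ^ ?k * ?Q - density * x ^ ?k = x ^ ?k * (?Q - density)" by (simp add: algebra_simps)
      then show ?thesis using x1 by (simp add: abs_mult)
    qed
    also have "\<dots> \<le> x ^ ?k * (2 * 4 ^ ?k / x)"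
      using x1 by (intro mult_left_mono local_product_minus_density_le) auto
    also have "\<dots> = 2 * 4 ^ ?k * x ^ (?k - 1)"
      using x1 assms finite_V by (simp add: power_eq_if card_gt_0_iff)
    also have "\<dots> \<le> 2 * 4 ^ ?k * (x ^ (?k - 1) * ln x ^ (?k - 1))"
      using lnx x1 by simp
    finally have 2: "\<bar>x ^ ?k * ?Q - density * x ^ ?k\<bar> \<le> 2 * 4 ^ ?k * (x ^ (?k - 1) * ln x ^ (?k - 1))" .
    have "\<bar>x ^ (?k - 1) * ln x ^ (?k - 1)\<bar> = x ^ (?k - 1) * ln x ^ (?k - 1)"
      using x1 lnx by simp
    then show ?thesis using 1 2 unfolding distrib_right by linarith
  qed
  then show ?thesis
    by (intro bigoI[of _ "A + 2 * 4 ^ ?k"] eventually_at_top_linorderI[of "exp 1"]) auto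
qed

end

subsection \<open>Binomial inversion\<close>

text \<open>Since (t choose j) (j choose r) = (t choose r) (t - r choose j - r), the sum is a
  multiple of an alternating binomial row sum, which vanishes unless t = r.\<close>

lemma sum_alternating_choose_choose:
  assumes "t \<le> M"
  shows "(\<Sum>j=r..M. (- 1) ^ (j - r) * real (j choose r) * real (t choose j)) = of_bool (t = r)"
proof (cases "r \<le> t")
  case False
  then have "(\<Sum>j=r..M. (- 1) ^ (j - r) * real (j choose r) * real (t choose j)) = 0"
    by (intro sum.neutral) (auto simp: binomial_eq_0)
  then show ?thesis using False by auto
next
  case True
  have "(\<Sum>j=r..M. (- 1) ^ (j - r) * real (j choose r) * real (t choose j))
      = (\<Sum>j=r..t. (- 1) ^ (j - r) * real (j choose r) * real (t choose j))"
    using assms by (intro sum.mono_neutral_right) (auto simp: binomial_eq_0)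
  also have "\<dots> = (\<Sum>j=r..t. real (t choose r) * ((- 1) ^ (j - r) * real ((t - r) choose (j - r))))"
  proof (rule sum.cong[OF refl])
    fix j assume "j \<in> {r..t}"
    then have "real (t choose j) * real (j choose r) = real (t choose r) * real ((t - r) choose (j - r))"
      by (simp add: choose_mult flip: of_nat_mult)
    then show "(- 1) ^ (j - r) * real (j choose r) * real (t choose j)
        = real (t choose r) * ((- 1) ^ (j - r) * real ((t - r) choose (j - r)))"
      by (simp add: mult_ac)
  qed
  also have "\<dots> = real (t choose r) * (\<Sum>i\<le>t - r. (- 1) ^ i * real ((t - r) choose i))"
    unfolding sum_distrib_left[symmetric]
    by (intro arg_cong[where f = "\<lambda>z. real (t choose r) * z"]
        sum.reindex_bij_witness[of _ "\<lambda>i. i + r" "\<lambda>j. j - r"]) (use True in auto)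
  also have "\<dots> = of_bool (t = r)"
    using choose_alternating_sum[of "t - r", where 'a = real] True by (cases "t = r") auto
  finally show ?thesis .
qed

text \<open>Induction on t by Pascal's rule: the shifted half is the previous identity at r - 1,
  which adds 1 exactly when t + 1 reaches r.\<close>

lemma sum_alternating_choose_pred_choose:
  assumes "t \<le> M" "r \<ge> 1"
  shows "(\<Sum>j=r..M. (- 1) ^ (j - r) * real ((j - 1) choose (r - 1)) * real (t choose j)) = of_bool (t \<ge> r)"
  using assms(1)
proof (induction t)
  case 0
  then show ?case using assms(2) by (auto simp: binomial_eq_0)
next
  case (Suc t)
  let ?w = "\<lambda>j. (- 1) ^ (j - r) * real ((j - 1) choose (r - 1))"
  obtain s where r: "r = Suc s" using assms(2) by (cases r) auto
  obtain M' where M: "M = Suc M'" using Suc.prems by (cases M) auto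
  have "(\<Sum>j=r..M. ?w j * real (Suc t choose j))
      = (\<Sum>j=r..M. ?w j * real (t choose j)) + (\<Sum>j=r..M. ?w j * real (t choose (j - 1)))"
    unfolding sum.distrib[symmetric]
  proof (rule sum.cong[OF refl])
    fix j assume "j \<in> {r..M}"
    then obtain i where "j = Suc i" using r by (cases j) auto
    then show "?w j * real (Suc t choose j) = ?w j * real (t choose j) + ?w j * real (t choose (j - 1))"
      by (simp add: distrib_left)
  qed
  also have "(\<Sum>j=r..M. ?w j * real (t choose (j - 1)))
      = (\<Sum>i=s..M'. (- 1) ^ (i - s) * real (i choose s) * real (t choose i))"
    unfolding r M by (subst sum.shift_bounds_cl_Suc_ivl) simp
  also have "\<dots> = of_bool (t = s)"
    using Suc.prems M by (intro sum_alternating_choose_choose) simp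
  also have "(\<Sum>j=r..M. ?w j * real (t choose j)) = of_bool (t \<ge> r)"
    using Suc by simp
  finally show ?case using r by auto
qed

subsection \<open>Coprimality graphs\<close>

text \<open>Unordered form of \<open>coprime_pairs\<close>, directly comparable with the edge set of
  a graph.\<close>

definition coprime_edges :: "nat \<Rightarrow> (nat \<Rightarrow> nat) \<Rightarrow> nat set set" where
  "coprime_edges k n = (\<lambda>(i, j). {i, j}) ` coprime_pairs k n"

lemma coprime_edges_subset: "coprime_edges k n \<subseteq> vertex_pairs k"
  by (auto simp: coprime_edges_def coprime_pairs_def vertex_pairs_def)

lemma card_coprime_edges: "card (coprime_edges k n) = card (coprime_pairs k n)"
  unfolding coprime_edges_def
  by (intro card_image) (auto simp: inj_on_def coprime_pairs_def doubleton_eq_iff)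

lemma vertex_pairs_eq: "vertex_pairs k = {e. e \<subseteq> {1..k} \<and> card e = 2}"
proof (intro set_eqI iffI)
  fix e assume "e \<in> {e. e \<subseteq> {1..k} \<and> card e = 2}"
  then obtain a b where "e = {a, b}" "a \<noteq> b" "{a, b} \<subseteq> {1..k}" by (auto simp: card_2_iff)
  then show "e \<in> vertex_pairs k"
    by (cases a b rule: linorder_cases) (auto simp: vertex_pairs_def insert_commute)
qed (auto simp: vertex_pairs_def)

lemma finite_vertex_pairs: "finite (vertex_pairs k)"
  unfolding vertex_pairs_eq by (rule finite_subset[of _ "Pow {1..k}"]) auto

lemma card_vertex_pairs: "card (vertex_pairs k) = k * (k - 1) div 2"
  unfolding vertex_pairs_eq by (subst n_subsets) (auto simp: choose_two)

lemma card_coprime_pairs_le: "card (coprime_pairs k n) \<le> k * (k - 1) div 2"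
  using card_mono[OF finite_vertex_pairs coprime_edges_subset, of k n]
  by (simp add: card_coprime_edges card_vertex_pairs)

text \<open>\<open>independent_in\<close> also tests i = j, where {i, j} is a singleton; singletons
  are independent because every edge has two elements.\<close>

lemma divisibility_pattern_independent_in:
  assumes "E \<subseteq> vertex_pairs k"
  shows "divisibility_pattern (vertices k) (independent_in E)"
proof
  fix v
  have "card e = 2" if "e \<in> E" for e using assms that by (auto simp: vertex_pairs_eq)
  then have "{v} \<notin> E" by force
  then show "independent_in E {v}" by (simp add: independent_in_def)
qed (auto simp: vertices_def independent_in_def)

text \<open>A gcd differs from 1 exactly when some prime divides both entries, that is, when both
  ends of the edge lie in the divisibility pattern of that prime.\<close>

lemma respects_pattern_independent_in:
  assumes E: "E \<subseteq> vertex_pairs k"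
  shows "divisibility_pattern.respects_pattern (vertices k) (independent_in E) n \<longleftrightarrow> E \<subseteq> coprime_edges k n"
proof -
  interpret divisibility_pattern "vertices k" "independent_in E"
    using E by (rule divisibility_pattern_independent_in)
  show ?thesis
  proof
    assume *: "respects_pattern n"
    show "E \<subseteq> coprime_edges k n"
    proof
      fix e assume e: "e \<in> E"
      then obtain i j where ij: "e = {i, j}" "1 \<le> i" "i < j" "j \<le> k"
        using E by (auto simp: vertex_pairs_def)
      have "gcd (n i) (n j) = 1"
      proof (rule ccontr)
        assume "gcd (n i) (n j) \<noteq> 1"
        then obtain p where "prime p" "p dvd gcd (n i) (n j)" using prime_factor_nat by blast
        then have "p dvd n i" "p dvd n j" "independent_in E {i \<in> vertices k. p dvd n i}"
          using * by (auto simp: respects_pattern_def)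
        then show False using e ij by (auto simp: independent_in_def vertices_def)
      qed
      then show "e \<in> coprime_edges k n"
        using ij by (auto simp: coprime_edges_def coprime_pairs_def intro!: image_eqI[of _ _ "(i, j)"])
    qed
  next
    assume *: "E \<subseteq> coprime_edges k n"
    show "respects_pattern n"
      unfolding respects_pattern_def independent_in_def
    proof (intro allI impI ballI notI)
      fix p i j assume p: "prime p" and i: "i \<in> {i \<in> vertices k. p dvd n i}"
        and j: "j \<in> {i \<in> vertices k. p dvd n i}" and e: "{i, j} \<in> E"
      have "{i, j} \<in> coprime_edges k n" using * e by (rule subsetD)
      then obtain a b where "{i, j} = {a, b}" "(a, b) \<in> coprime_pairs k n"
        unfolding coprime_edges_def by (elim imageE) (simp split: prod.splits)
      then have "gcd (n i) (n j) = 1" by (auto simp: coprime_pairs_def doubleton_eq_iff gcd.commute)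
      moreover have "p dvd gcd (n i) (n j)" using i j by simp
      ultimately show False using p not_prime_1 by auto
    qed
  qed
qed

text \<open>Grouping the independent sets by size turns each local factor into the polynomial with
  coefficients \<open>num_independent\<close>.\<close>

lemma density_independent_in:
  assumes E: "E \<subseteq> vertex_pairs k"
  shows "divisibility_pattern.density (vertices k) (independent_in E) = A_graph k E"
proof -
  interpret divisibility_pattern "vertices k" "independent_in E"
    using E by (rule divisibility_pattern_independent_in)
  let ?V = "vertices k"
  have cV: "card ?V = k" by (simp add: vertices_def)
  have "local_density q = (\<Sum>m=0..k. real (num_independent k E m) * (q ^ m * (1 - q) ^ (k - m)))" for q
  proof -
    let ?J = "{T \<in> Pow ?V. independent_in E T}"
    have fJ: "finite ?J" using finite_V by simp
    have sub: "card ` ?J \<subseteq> {0..k}" using card_mono[OF finite_V] cV by auto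
    have "local_density q = (\<Sum>T\<in>?J. q ^ card T * (1 - q) ^ (k - card T))"
      unfolding local_density_def cV using finite_V by (intro sum.mono_neutral_cong_right) auto
    also have "\<dots> = (\<Sum>m=0..k. \<Sum>T\<in>{T\<in>?J. card T = m}. q ^ card T * (1 - q) ^ (k - card T))"
      by (rule sum.group[OF fJ _ sub, symmetric]) simp
    also have "\<dots> = (\<Sum>m=0..k. \<Sum>T\<in>{T\<in>?J. card T = m}. q ^ m * (1 - q) ^ (k - m))"
      by (intro sum.cong) auto
    also have "\<dots> = (\<Sum>m=0..k. real (num_independent k E m) * (q ^ m * (1 - q) ^ (k - m)))"
    proof (rule sum.cong[OF refl])
      fix m
      have "{T\<in>?J. card T = m} = {S. S \<subseteq> ?V \<and> card S = m \<and> independent_in E S}" by auto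
      then show "(\<Sum>T\<in>{T\<in>?J. card T = m}. q ^ m * (1 - q) ^ (k - m))
          = real (num_independent k E m) * (q ^ m * (1 - q) ^ (k - m))"
        by (simp add: num_independent_def)
    qed
    finally show ?thesis .
  qed
  then have "local_density (1 / real p)
      = (\<Sum>m=0..k. real (num_independent k E m) / real p ^ m * (1 - 1 / real p) ^ (k - m))" for p
    by (simp add: power_one_over)
  then show ?thesis
    unfolding density_def A_graph_def by (simp only:)
qed

section \<open>Counts of tuples by number of coprime pairs, and their densities\<close>

lemma coprime_graph_count_asymptotics:
  assumes k: "k \<ge> 1" and E: "E \<subseteq> vertex_pairs k"
  shows "(\<lambda>x. (\<Sum>n\<in>pos_tuples_le k x. of_bool (E \<subseteq> coprime_edges k n)) - A_graph k E * x ^ k)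
     \<in> O[at_top](\<lambda>x. x ^ (k - 1) * ln x ^ (k - 1))"
proof -
  interpret divisibility_pattern "vertices k" "independent_in E"
    using E by (rule divisibility_pattern_independent_in)
  have "card (vertices k) = k" "vertices k \<noteq> {}" using k by (auto simp: vertices_def)
  then show ?thesis
    using count_asymptotics
    by (simp add: count_def tuples_le_def pos_tuples_le_def density_independent_in[OF E]
        respects_pattern_independent_in[OF E])
qed

text \<open>The binomial coefficient counts the graphs with j edges contained in the coprimality
  graph of n, so the sum of \<open>f\<close> is a finite linear combination of counts with known
  asymptotics. Both parts of the theorem are instances with different weights
  \<open>w\<close>.\<close>

lemma weighted_count_asymptotics:
  fixes w :: "nat \<Rightarrow> real" and f :: "(nat \<Rightarrow> nat) \<Rightarrow> real"
  assumes k: "k \<ge> 1"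
    and f: "\<And>n. f n = (\<Sum>j=r..M. w j * real (card (coprime_pairs k n) choose j))"
  shows "(\<lambda>x. (\<Sum>n\<in>pos_tuples_le k x. f n) -
      (\<Sum>j=r..M. w j * (\<Sum>E | E \<subseteq> vertex_pairs k \<and> card E = j. A_graph k E)) * x ^ k)
     \<in> O[at_top](\<lambda>x. x ^ (k - 1) * ln x ^ (k - 1))"
proof -
  let ?c = "\<lambda>E x. \<Sum>n\<in>pos_tuples_le k x. of_bool (E \<subseteq> coprime_edges k n) :: real"
  have choose: "real (card (coprime_pairs k n) choose j)
      = (\<Sum>E | E \<subseteq> vertex_pairs k \<and> card E = j. of_bool (E \<subseteq> coprime_edges k n))" for n j
  proof -
    have "finite (coprime_edges k n)" using finite_subset[OF coprime_edges_subset finite_vertex_pairs] .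
    then have "card (coprime_pairs k n) choose j = card {E. E \<subseteq> coprime_edges k n \<and> card E = j}"
      by (simp add: n_subsets card_coprime_edges)
    also have "{E. E \<subseteq> coprime_edges k n \<and> card E = j}
        = {E. E \<subseteq> vertex_pairs k \<and> card E = j} \<inter> {E. E \<subseteq> coprime_edges k n}"
      using coprime_edges_subset by blast
    finally show ?thesis
      using finite_vertex_pairs[of k] by simp
  qed
  have sum_f: "(\<Sum>n\<in>pos_tuples_le k x. f n)
      = (\<Sum>j=r..M. w j * (\<Sum>E | E \<subseteq> vertex_pairs k \<and> card E = j. ?c E x))" for x
  proof -
    have "(\<Sum>n\<in>pos_tuples_le k x. f n) = (\<Sum>j=r..M. \<Sum>n\<in>pos_tuples_le k x. w j *
        (\<Sum>E | E \<subseteq> vertex_pairs k \<and> card E = j. of_bool (E \<subseteq> coprime_edges k n)))"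
      unfolding f choose by (rule sum.swap)
    also have "\<dots> = (\<Sum>j=r..M. w j * (\<Sum>E | E \<subseteq> vertex_pairs k \<and> card E = j. ?c E x))"
      unfolding sum_distrib_left[symmetric]
      by (intro sum.cong refl arg_cong2[where f = "(*)"] sum.swap)
    finally show ?thesis .
  qed
  have eq: "(\<Sum>n\<in>pos_tuples_le k x. f n) -
      (\<Sum>j=r..M. w j * (\<Sum>E | E \<subseteq> vertex_pairs k \<and> card E = j. A_graph k E)) * x ^ k
    = (\<Sum>j=r..M. w j * (\<Sum>E | E \<subseteq> vertex_pairs k \<and> card E = j. ?c E x - A_graph k E * x ^ k))" for x
    unfolding sum_f
    by (simp only: sum_distrib_right sum_subtractf right_diff_distrib mult.assoc)
  show ?thesis
    unfolding eq
  proof (intro big_sum_in_bigo)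
    fix j
    have "(\<lambda>x. \<Sum>E | E \<subseteq> vertex_pairs k \<and> card E = j. ?c E x - A_graph k E * x ^ k)
        \<in> O[at_top](\<lambda>x. x ^ (k - 1) * ln x ^ (k - 1))"
      using coprime_graph_count_asymptotics[OF k] by (intro big_sum_in_bigo) auto
    then show "(\<lambda>x. w j * (\<Sum>E | E \<subseteq> vertex_pairs k \<and> card E = j. ?c E x - A_graph k E * x ^ k))
        \<in> O[at_top](\<lambda>x. x ^ (k - 1) * ln x ^ (k - 1))"
      by (cases "w j = 0") auto
  qed
qed

text \<open>Divided by x ^ k the error becomes ln x ^ (k - 1) / x, which tends to 0, as substituting
  y = ln x shows. The limit along the reals then restricts to the naturals.\<close>

lemma has_asymptotic_densityI:
  fixes T :: "(nat \<Rightarrow> nat) set"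
  assumes k: "k \<ge> 1"
    and O: "(\<lambda>x. real (card (T \<inter> pos_tuples_le k x)) - C * x ^ k) \<in> O[at_top](\<lambda>x. x ^ (k - 1) * ln x ^ (k - 1))"
  shows "has_asymptotic_density k T C"
proof -
  have "((\<lambda>x::real. ln x ^ (k - 1) / exp (ln x)) \<longlongrightarrow> 0) at_top"
    by (rule filterlim_compose[OF tendsto_power_div_exp_0 ln_at_top])
  then have "((\<lambda>x::real. x ^ (k - 1) * ln x ^ (k - 1) / x ^ k) \<longlongrightarrow> 0) at_top"
  proof (rule Lim_transform_eventually)
    show "\<forall>\<^sub>F x::real in at_top. ln x ^ (k - 1) / exp (ln x) = x ^ (k - 1) * ln x ^ (k - 1) / x ^ k"
      using eventually_gt_at_top[of 0] by eventually_elim (use k in \<open>cases k; simp\<close>)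
  qed
  moreover have ev: "\<forall>\<^sub>F x::real in at_top. x ^ k \<noteq> 0"
    using eventually_gt_at_top[of 0] by eventually_elim simp
  ultimately have "(\<lambda>x::real. x ^ (k - 1) * ln x ^ (k - 1)) \<in> o[at_top](\<lambda>x. x ^ k)"
    by (intro smalloI_tendsto) auto
  then have "(\<lambda>x. real (card (T \<inter> pos_tuples_le k x)) - C * x ^ k) \<in> o[at_top](\<lambda>x. x ^ k)"
    using O landau_o.big_small_trans by blast
  then have "((\<lambda>x. (real (card (T \<inter> pos_tuples_le k x)) - C * x ^ k) / x ^ k) \<longlongrightarrow> 0) at_top"
    by (rule smalloD_tendsto)
  then have "((\<lambda>x. (real (card (T \<inter> pos_tuples_le k x)) - C * x ^ k) / x ^ k + C) \<longlongrightarrow> 0 + C) at_top"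
    by (intro tendsto_intros)
  then have "((\<lambda>x. real (card (T \<inter> pos_tuples_le k x)) / x ^ k) \<longlongrightarrow> 0 + C) at_top"
  proof (rule Lim_transform_eventually)
    show "\<forall>\<^sub>F x in at_top. (real (card (T \<inter> pos_tuples_le k x)) - C * x ^ k) / x ^ k + C
        = real (card (T \<inter> pos_tuples_le k x)) / x ^ k"
      using ev by eventually_elim (simp add: field_simps)
  qed
  then have "((\<lambda>x. real (card (T \<inter> pos_tuples_le k x)) / x ^ k) \<longlongrightarrow> C) at_top" by simp
  then show ?thesis
    unfolding has_asymptotic_density_def
    by (rule filterlim_compose[OF _ filterlim_real_sequentially])
qed

lemma card_Int_pos_tuples_le:
  "real (card ({n \<in> pos_tuples k. Q n} \<inter> pos_tuples_le k x)) = (\<Sum>n\<in>pos_tuples_le k x. if Q n then 1 else 0)"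
proof -
  have "{n \<in> pos_tuples k. Q n} \<inter> pos_tuples_le k x = pos_tuples_le k x \<inter> {n. Q n}"
    by (auto simp: pos_tuples_def pos_tuples_le_def PiE_iff)
  then show ?thesis
    using finite_pos_tuples_le by (simp add: sum.If_cases)
qed

theorem theorem6:
  fixes k :: nat
  assumes "k \<ge> 2"
  shows
    "(\<forall>r::nat. (\<lambda>x::real. (\<Sum>n\<in>pos_tuples_le k x. beta_exact k r n) - C_exact k r * x ^ k)
        \<in> O[at_top](\<lambda>x. x ^ (k - 1) * ln x ^ (k - 1))) \<and>
     (\<forall>r\<ge>1. (\<lambda>x::real. (\<Sum>n\<in>pos_tuples_le k x. beta_atleast k r n) - C_atleast k r * x ^ k)
        \<in> O[at_top](\<lambda>x. x ^ (k - 1) * ln x ^ (k - 1))) \<and>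
     (\<forall>r::nat. has_asymptotic_density k
        {n \<in> pos_tuples k. card (coprime_pairs k n) = r} (C_exact k r)) \<and>
     (\<forall>r\<ge>1. has_asymptotic_density k
        {n \<in> pos_tuples k. card (coprime_pairs k n) \<ge> r} (C_atleast k r))"
proof -
  have k: "k \<ge> 1" using assms by simp
  \<comment> \<open>Here and below, inversion applies because the number of coprime pairs never
    exceeds the upper summation limit k * (k - 1) div 2.\<close>
  have exact: "(\<lambda>x. (\<Sum>n\<in>pos_tuples_le k x. beta_exact k r n) - C_exact k r * x ^ k)
      \<in> O[at_top](\<lambda>x. x ^ (k - 1) * ln x ^ (k - 1))" for r
    unfolding C_exact_def
    by (rule weighted_count_asymptotics[OF k])
       (subst sum_alternating_choose_choose[OF card_coprime_pairs_le], simp add: beta_exact_def)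
  have atleast: "(\<lambda>x. (\<Sum>n\<in>pos_tuples_le k x. beta_atleast k r n) - C_atleast k r * x ^ k)
      \<in> O[at_top](\<lambda>x. x ^ (k - 1) * ln x ^ (k - 1))" if "r \<ge> 1" for r
    unfolding C_atleast_def
    by (rule weighted_count_asymptotics[OF k])
       (subst sum_alternating_choose_pred_choose[OF card_coprime_pairs_le that], simp add: beta_atleast_def)
  have "has_asymptotic_density k {n \<in> pos_tuples k. card (coprime_pairs k n) = r} (C_exact k r)" for r
    using exact[of r] by (intro has_asymptotic_densityI k) (simp add: card_Int_pos_tuples_le beta_exact_def)
  moreover have "has_asymptotic_density k {n \<in> pos_tuples k. card (coprime_pairs k n) \<ge> r} (C_atleast k r)"
    if "r \<ge> 1" for r
    using atleast[OF that] by (intro has_asymptotic_densityI k) (simp add: card_Int_pos_tuples_le beta_atleast_def)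
  ultimately show ?thesis using exact atleast by blast
qed

end
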